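(* Let $k$ be a positive integer, $l>0$, and let $\{T_1,\ldots,T_N\}$ be a normal $k$-fold translative packing of $lI^2$ with $T$. For $i=1,\ldots,N$, let $r_i$ be the non-negative integer such that $S_i$ is a half-open $r_i$-stair polygon. Then $$\sum_{i=1}^{N}r_i\leq (2k-1)N.$$
   Context: $T$ is the closed triangle with vertices $(0,0),(1,0),(0,1)$; $I=[0,1)$, so $lI^2=[0,l)^2$. A normal $k$-fold translative packing of $lI^2$ with $T$ is a finite family $\{T_1,\ldots,T_N\}$ of pairwise distinct translates of $T$, all contained in $lI^2$, such that each point of $lI^2$ belongs to the interiors of at most $k$ of the $T_i$. For a translate $T'=T+(x,y)$, put $I^2(T')=[x,x+1)\times[y,y+1)$ and $v(T')=(x,y)$. For points of $\mathbb{R}^2$, $(x_1,y_1)\prec(x_2,y_2)$ means that either $x_1+y_1<x_2+y_2$, or $x_1+y_1=x_2+y_2$ and $x_1<x_2$. For distinct translates $T',T''$ of $T$ with $I^2(T')\cap I^2(T'')\neq\emptyset$, $T'$ presses $T''$ if $v(T'')\prec v(T')$. For a nonempty bounded set $K$, $v(K)$ is the $\prec$-greatest point $u$ such that $u\prec u'$ or $u=u'$ for all $u'\in K$; for a nonempty half-open rectangle, $v([a,b)\times[c,d))=(a,c)$. Let $R(x_0,y_0)=\{(x,y):x\ge x_0,\ y\ge y_0\}$. Let $\mathcal{C}_i$ be the collection of those $T_j$ that press $T_i$, let $$U_i=\bigcup R\bigl(v(I^2(T_{i_1})\cap\cdots\cap I^2(T_{i_k}))\bigr),$$ the union over all choices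 of $k$ distinct $T_{i_1},\ldots,T_{i_k}\in\mathcal{C}_i$ with $I^2(T_{i_1})\cap\cdots\cap I^2(T_{i_k})\neq\emptyset$, and let $S_i=I^2(T_i)\setminus U_i$. For an integer $r\ge0$, a half-open $r$-stair polygon is a set of the form $\bigcup_{j=0}^{r}[x_j,x_{j+1})\times[y_{r+1},y_j)$ with $x_0<x_1<\cdots<x_{r+1}$ and $y_0>y_1>\cdots>y_{r+1}$. Each $S_i$ is a half-open $r_i$-stair polygon for a unique integer $r_i\ge0$. *)

theory Defs
  imports "HOL-Analysis.Analysis"
begin

definition triangle :: "(real \<times> real) set" where
  "triangle = convex hull {(0, 0), (1, 0), (0, 1)}"

definition translate_of_triangle :: "(real \<times> real) set \<Rightarrow> bool" where
  "translate_of_triangle D \<longleftrightarrow> (\<exists>p. D = (+) p ` triangle)"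

text \<open>A family of pairwise distinct translates is represented as a set of translates.\<close>

definition normal_packing :: "nat \<Rightarrow> real \<Rightarrow> (real \<times> real) set set \<Rightarrow> bool" where
  "normal_packing k l P \<longleftrightarrow>
     finite P \<and>
     (\<forall>D\<in>P. translate_of_triangle D \<and> D \<subseteq> {0..<l} \<times> {0..<l}) \<and>
     (\<forall>q\<in>{0..<l} \<times> {0..<l}. card {D \<in> P. q \<in> interior D} \<le> k)"

definition prec :: "real \<times> real \<Rightarrow> real \<times> real \<Rightarrow> bool" (infix "\<prec>" 50) where
  "p \<prec> q \<longleftrightarrow> fst p + snd p < fst q + snd q \<or> (fst p + snd p = fst q + snd q \<and> fst p < fst q)"

definition prec_lower_bound :: "real \<times> real \<Rightarrow> (real \<times> real) set \<Rightarrow> bool" where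
  "prec_lower_bound u K \<longleftrightarrow> (\<forall>u'\<in>K. u \<prec> u' \<or> u = u')"

text \<open>The point \<open>v(K)\<close>, the greatest lower bound of \<open>K\<close> with respect to \<open>\<prec>\<close>. It need not exist
  for an arbitrary bounded set; it does for nonempty half-open rectangles and for translates of
  the triangle (lemmas \<open>corner_rectangle\<close> and \<open>corner_translate\<close>).\<close>

definition corner :: "(real \<times> real) set \<Rightarrow> real \<times> real" where
  "corner K = (THE u. prec_lower_bound u K \<and> (\<forall>w. prec_lower_bound w K \<longrightarrow> w \<prec> u \<or> w = u))"

text \<open>The vector \<open>v(D)\<close> of a translate \<open>D\<close>; it agrees with \<open>corner D\<close> (lemmas \<open>tvec_translate\<close> and
  \<open>corner_translate\<close>).\<close>

definition tvec :: "(real \<times> real) set \<Rightarrow> real \<times> real" where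
  "tvec D = (THE p. D = (+) p ` triangle)"

definition unit_square :: "(real \<times> real) set \<Rightarrow> (real \<times> real) set" where
  "unit_square D =
     {fst (tvec D)..<fst (tvec D) + 1} \<times> {snd (tvec D)..<snd (tvec D) + 1}"

definition presses :: "(real \<times> real) set \<Rightarrow> (real \<times> real) set \<Rightarrow> bool" where
  "presses D E \<longleftrightarrow> D \<noteq> E \<and> unit_square D \<inter> unit_square E \<noteq> {} \<and> tvec E \<prec> tvec D"

definition quadrant :: "real \<times> real \<Rightarrow> (real \<times> real) set" where
  "quadrant p = {fst p..} \<times> {snd p..}"

definition pressing :: "(real \<times> real) set set \<Rightarrow> (real \<times> real) set \<Rightarrow> (real \<times> real) set set" where
  "pressing P D = {E \<in> P. presses E D}"

definition cut_region :: "nat \<Rightarrow> (real \<times> real) set set \<Rightarrow> (real \<times> real) set \<Rightarrow> (real \<times> real) set" where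
  "cut_region k P D =
     (\<Union>F \<in> {F. F \<subseteq> pressing P D \<and> card F = k \<and> (\<Inter>E\<in>F. unit_square E) \<noteq> {}}.
        quadrant (corner (\<Inter>E\<in>F. unit_square E)))"

definition stair_region :: "nat \<Rightarrow> (real \<times> real) set set \<Rightarrow> (real \<times> real) set \<Rightarrow> (real \<times> real) set" where
  "stair_region k P D = unit_square D - cut_region k P D"

definition stair_polygon :: "nat \<Rightarrow> (real \<times> real) set \<Rightarrow> bool" where
  "stair_polygon r S \<longleftrightarrow>
     (\<exists>x y :: nat \<Rightarrow> real.
        (\<forall>j\<le>r. x j < x (Suc j)) \<and> (\<forall>j\<le>r. y (Suc j) < y j) \<and>
        S = (\<Union>j\<le>r. {x j..<x (Suc j)} \<times> {y (Suc r)..<y j}))"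

lemma corner_eqI:
  assumes "u \<in> K" "prec_lower_bound u K"
  shows "corner K = u"
  unfolding corner_def
proof (rule the_equality)
  show "prec_lower_bound u K \<and> (\<forall>w. prec_lower_bound w K \<longrightarrow> w \<prec> u \<or> w = u)"
    using assms unfolding prec_lower_bound_def by blast
next
  fix w
  assume w: "prec_lower_bound w K \<and> (\<forall>z. prec_lower_bound z K \<longrightarrow> z \<prec> w \<or> z = w)"
  then have "w \<prec> u \<or> w = u" "u \<prec> w \<or> u = w"
    using assms unfolding prec_lower_bound_def by metis+
  then show "w = u"
    by (auto simp: prec_def)
qed

lemma corner_rectangle:
  assumes "a < b" "c < d"
  shows "corner ({a..<b} \<times> {c..<d}) = (a, c)"
  by (rule corner_eqI) (use assms in \<open>auto simp: prec_lower_bound_def prec_def\<close>)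

lemma triangle_ge0: "q \<in> triangle \<Longrightarrow> 0 \<le> fst q \<and> 0 \<le> snd q"
  by (auto simp: triangle_def convex_hull_3)

lemma corner_translate: "corner ((+) p ` triangle) = p"
proof (rule corner_eqI)
  have "(0, 0) \<in> triangle"
    by (simp add: triangle_def hull_inc)
  then show "p \<in> (+) p ` triangle"
    by (metis add.right_neutral image_eqI zero_prod_def)
  show "prec_lower_bound p ((+) p ` triangle)"
    by (auto simp: prec_lower_bound_def prec_def prod_eq_iff dest!: triangle_ge0)
qed

lemma tvec_translate: "tvec ((+) p ` triangle) = p"
  unfolding tvec_def
  by (rule the_equality) (auto, metis corner_translate)

end

theory Submission
  imports Defs
begin

text \<open>
  The \<open>r D\<close> steps of the staircase of \<open>D\<close> have \<open>r D\<close> reflex vertices, and these are what is counted.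
  A reflex vertex \<open>(a, b)\<close> of the staircase lies strictly inside the square of \<open>D\<close>. At least \<open>k\<close> of the squares
  that press \<open>D\<close> contain it, but fewer than \<open>k\<close> of these start to the left of the line \<open>x = a\<close>, and
  fewer than \<open>k\<close> start below the line \<open>y = b\<close> (\<open>stair_reflex\<close>). Hence some pressing square \<open>e\<close> has
  its left edge on \<open>x = a\<close> and some pressing square \<open>f\<close> has its bottom edge on \<open>y = b\<close>. So the vertex is
  either the lower left corner of a single square \<open>e = f\<close>, or a point where a left edge crosses
  a bottom edge.

  Suppose first that different squares share no edge lines. Then a point is a reflex vertex for at
  most one \<open>D\<close>, namely the one with exactly \<open>k\<close> squares above it in the order among those containing
  the point. There are \<open>N\<close> lower left corners, and it remains to count the crossings. A crossing of the
  left edge of \<open>e\<close> with the bottom edge of \<open>f\<close> is charged to the smaller of \<open>e\<close> and \<open>f\<close>. If this is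
  \<open>e\<close>, then \<open>f\<close> contains every point of the left edge of \<open>e\<close> from the crossing upwards, and it presses
  every square that \<open>e\<close> presses and that meets \<open>f\<close>. At the topmost charged crossing of \<open>e\<close>, all these \<open>f\<close> are therefore
  pressing squares that start to the left of the vertex, so there are at most \<open>k - 1\<close> of them
  (\<open>card_left_crossings\<close>). The same holds for bottom edges by reflection in the diagonal. Altogether
  there are at most \<open>N + 2 (k - 1) N = (2 k - 1) N\<close> reflex vertices.

  When edge lines coincide, one point can be a reflex vertex for several \<open>D\<close>. It is then also a
  crossing for many pairs \<open>(e, f)\<close>, and \<open>card_reflex_at\<close> shows that there are enough of them.
\<close>

section \<open>Stacks of half-open unit squares\<close>

lemma sum_card_fibres:
  assumes "finite S" "finite T" "g ` S \<subseteq> T"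
  shows "(\<Sum>c\<in>T. card {s \<in> S. g s = c}) = card S"
  using sum.group[OF assms, of "\<lambda>_. 1 :: nat"] by simp

text \<open>
  The element \<open>m\<close> stands for the square \<open>[x m, x m + 1) \<times> [y m, y m + 1)\<close>, and \<open>lt d m\<close> says that \<open>m\<close>
  presses \<open>d\<close> whenever the two squares meet. The assumptions treat \<open>x\<close> and \<open>y\<close> alike, so exchanging the
  coordinates gives another stack with the same order: this is the reflection in the diagonal.
\<close>

locale square_stack =
  fixes P :: "'a set" and x y :: "'a \<Rightarrow> real" and lt :: "'a \<Rightarrow> 'a \<Rightarrow> bool" and k :: nat
  assumes finite_P: "finite P"
    and lt_irrefl: "\<not> lt d d"
    and lt_trans: "lt d e \<Longrightarrow> lt e f \<Longrightarrow> lt d f"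
    and lt_total: "d \<in> P \<Longrightarrow> e \<in> P \<Longrightarrow> d \<noteq> e \<Longrightarrow> lt d e \<or> lt e d"
    and k_pos: "0 < k"
begin

definition above :: "'a \<Rightarrow> real \<Rightarrow> real \<Rightarrow> 'a set" where
  "above d a b = {m \<in> P. lt d m \<and> x m \<le> a \<and> a < x m + 1 \<and> y m \<le> b \<and> b < y m + 1}"

text \<open>
  For \<open>lt\<close> the order of the translates, these are the points where the staircase of \<open>d\<close> turns inwards,
  described by counting pressing squares instead of by corners of \<open>k\<close>-fold intersections.
\<close>

definition reflex :: "'a \<Rightarrow> real \<Rightarrow> real \<Rightarrow> bool" where
  "reflex d a b \<longleftrightarrow>
     d \<in> P \<and> x d < a \<and> a < x d + 1 \<and> y d < b \<and> b < y d + 1 \<and>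
     k \<le> card (above d a b) \<and>
     card {m \<in> above d a b. x m < a} < k \<and> card {m \<in> above d a b. y m < b} < k"

text \<open>
  Only crossings that occur as reflex vertices of some square below both \<open>e\<close> and \<open>f\<close> are counted: it is
  the bound on the depth at a reflex vertex that limits their number.
\<close>

definition crossing :: "'a \<Rightarrow> 'a \<Rightarrow> bool" where
  "crossing e f \<longleftrightarrow> x f < x e \<and> y e < y f \<and>
     (\<exists>d. reflex d (x e) (y f) \<and> e \<in> above d (x e) (y f) \<and> f \<in> above d (x e) (y f))"

lemma finite_above [simp]: "finite (above d a b)"
  using finite_P by (simp add: above_def)

lemma crossing_in_P: "crossing e f \<Longrightarrow> e \<in> P \<and> f \<in> P"
  by (auto simp: crossing_def above_def)

lemma finite_crossing: "finite {(e, f). crossing e f}"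
  by (rule finite_subset[of _ "P \<times> P"]) (use crossing_in_P finite_P in auto)

text \<open>
  The left edge of \<open>e\<close> has length 1, so a square \<open>f\<close> that starts above the lower end of this edge
  reaches beyond its upper end. All \<open>f\<close> counted here thus contain the topmost crossing. If that is a
  reflex vertex of \<open>d\<close>, they lie above \<open>d\<close> because \<open>e\<close> does, and they start to the left of the vertex.
\<close>

lemma card_left_crossings: "card {f. crossing e f \<and> lt e f} \<le> k - 1"
proof (cases "{f. crossing e f \<and> lt e f} = {}")
  case False
  let ?L = "{f. crossing e f \<and> lt e f}"
  have fin: "finite ?L"
    by (rule finite_subset[OF _ finite_P]) (use crossing_in_P in auto)
  obtain g where g: "g \<in> ?L" and max: "Max (y ` ?L) = y g"
    using obtains_MAX[OF fin False] .
  have top: "y f \<le> y g" if "f \<in> ?L" for f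
    unfolding max[symmetric] using fin that by simp
  obtain d where d: "reflex d (x e) (y g)" "e \<in> above d (x e) (y g)" "g \<in> above d (x e) (y g)"
    using g by (auto simp: crossing_def)
  have "f \<in> {m \<in> above d (x e) (y g). x m < x e}" if f: "f \<in> ?L" for f
  proof -
    have "f \<in> P" "x f < x e" "y e < y f" "lt e f" "x e < x f + 1"
      using f by (auto simp: crossing_def above_def)
    then show ?thesis
      using d(2) top[OF f] lt_trans by (auto simp: above_def)
  qed
  then have "card ?L \<le> card {m \<in> above d (x e) (y g). x m < x e}"
    by (intro card_mono) auto
  then show ?thesis
    using d(1) by (auto simp: reflex_def)
qed (simp only: card.empty)

lemma card_bottom_crossings: "card {e. crossing e f \<and> lt f e} \<le> k - 1"
proof -
  interpret swap: square_stack P y x lt k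
    by (rule square_stack_axioms)
  have above: "swap.above d b a = above d a b" for d a b
    by (auto simp: swap.above_def above_def)
  have "swap.reflex d b a = reflex d a b" for d a b
    by (auto simp: swap.reflex_def reflex_def above)
  then have "swap.crossing f e = crossing e f" for e
    by (auto simp: swap.crossing_def crossing_def above)
  then show ?thesis
    using swap.card_left_crossings[of f] by simp
qed

lemma card_crossing: "card {(e, f). crossing e f} \<le> 2 * (k - 1) * card P"
proof -
  let ?L = "SIGMA e:P. {f. crossing e f \<and> lt e f}"
  let ?B = "SIGMA f:P. {e. crossing e f \<and> lt f e}"
  have fin: "finite {f. crossing e f \<and> lt e f}" "finite {e. crossing e f \<and> lt f e}" for e f
    by (rule finite_subset[OF _ finite_P], use crossing_in_P in auto)+
  have "{(e, f). crossing e f} \<subseteq> ?L \<union> prod.swap ` ?B"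
  proof (rule subrelI)
    fix e f assume "(e, f) \<in> {(e, f). crossing e f}"
    then have c: "crossing e f" by simp
    then have "e \<noteq> f" by (auto simp: crossing_def)
    then have "lt e f \<or> lt f e"
      using crossing_in_P[OF c] lt_total by blast
    then show "(e, f) \<in> ?L \<union> prod.swap ` ?B"
      using c crossing_in_P[OF c] by (auto simp: image_iff)
  qed
  then have "card {(e, f). crossing e f} \<le> card (?L \<union> prod.swap ` ?B)"
    by (rule card_mono[rotated]) (use finite_P fin in auto)
  also have "\<dots> \<le> card ?L + card ?B"
    by (intro order_trans[OF card_Un_le] add_mono card_image_le order_refl)
       (use finite_P fin in auto)
  also have "card ?L \<le> card P * (k - 1)"
    using finite_P fin card_left_crossings sum_bounded_above[of P _ "k - 1"] by simp
  also have "card ?B \<le> card P * (k - 1)"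
    using finite_P fin card_bottom_crossings sum_bounded_above[of P _ "k - 1"] by simp
  finally show ?thesis by (simp add: algebra_simps)
qed

text \<open>
  In its use below, \<open>e\<close> squares have their lower left corner at a given point, \<open>p\<close> others only their
  left edge and \<open>q\<close> others only their bottom edge through it.
\<close>

lemma le_add_mult_if_le_add:
  fixes n e p q :: nat
  assumes "n \<le> e + p" "n \<le> e + q"
  shows "n \<le> e + p * q"
proof (cases "q = 0")
  case False
  then have "p \<le> p * q" by simp
  with assms(1) show ?thesis by linarith
qed (use assms in simp)

text \<open>
  Let \<open>s\<close> be the greatest and \<open>t\<close> the least of the \<open>n\<close> squares having \<open>(a, b)\<close> as a reflex vertex. At
  least \<open>k\<close> squares above \<open>s\<close> contain the point. All of them are also above \<open>t\<close>, and so are \<open>n - 1\<close>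
  further squares, those among the \<open>n\<close> other than \<open>t\<close>, which contain the point strictly inside. Since
  fewer than \<open>k\<close> squares above \<open>t\<close> start to the left of the point, at most \<open>k - n\<close> of those above \<open>s\<close>
  do, which leaves at least \<open>n\<close> squares whose left edge is on the line \<open>x = a\<close>. Likewise at least \<open>n\<close> squares have their
  bottom edge on \<open>y = b\<close>. These two sets of squares combine into enough corners and crossings.
\<close>

lemma card_reflex_at:
  "card {d. reflex d a b} \<le>
     card {e \<in> P. (x e, y e) = (a, b)} + card {(e, f). crossing e f \<and> (x e, y f) = (a, b)}"
proof (cases "{d. reflex d a b} = {}")
  case False
  let ?N = "{d. reflex d a b}"
  have NP: "?N \<subseteq> P" by (auto simp: reflex_def)
  then have fin: "finite ?N" using finite_P finite_subset by blast
  have trans: "transp_on ?N lt"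
    using lt_trans unfolding transp_on_def by blast
  have total: "totalp_on ?N lt"
    using NP lt_total by (auto simp: totalp_on_def)
  obtain s where s: "s \<in> ?N" and s_max: "\<And>d. d \<in> ?N \<Longrightarrow> d = s \<or> lt d s"
    using Finite_Set.bex_greatest_element[OF fin False trans total] by blast
  obtain t where t: "t \<in> ?N" and t_min: "\<And>d. d \<in> ?N \<Longrightarrow> d = t \<or> lt t d"
    using Finite_Set.bex_least_element[OF fin False trans total] by blast
  let ?A = "above s a b"
  have sub: "?A \<union> (?N - {t}) \<subseteq> above t a b"
  proof
    fix m assume m: "m \<in> ?A \<union> (?N - {t})"
    then have "lt t m"
      using t_min[OF s] t_min[of m] lt_trans[of t s m] by (auto simp: above_def)
    with m show "m \<in> above t a b"
      by (auto simp: above_def reflex_def)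
  qed
  have disj: "?A \<inter> ?N = {}"
  proof -
    have "lt s d" if "d \<in> ?A" for d
      using that by (simp add: above_def)
    then show ?thesis
      using s_max lt_irrefl lt_trans by blast
  qed
  \<comment> \<open>The same count serves both coordinates: \<open>(z, c)\<close> will be \<open>(x, a)\<close> and \<open>(y, b)\<close>.\<close>
  have many: "card ?N \<le> card {m \<in> ?A. z m = c}"
    if low: "card {m \<in> above t a b. z m < c} < k"
      and below: "\<And>d. d \<in> ?N \<Longrightarrow> z d < c" "\<And>m. m \<in> ?A \<Longrightarrow> z m \<le> c"
    for z :: "'a \<Rightarrow> real" and c
  proof -
    have "card {m \<in> ?A. z m < c} + card (?N - {t}) = card ({m \<in> ?A. z m < c} \<union> (?N - {t}))"
      using fin disj by (subst card_Un_disjoint) auto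
    also have "\<dots> \<le> card {m \<in> above t a b. z m < c}"
      using sub below(1) by (intro card_mono) auto
    finally have 1: "card {m \<in> ?A. z m < c} + card (?N - {t}) < k" using low by linarith
    have "card ?A = card ({m \<in> ?A. z m < c} \<union> {m \<in> ?A. z m = c})"
      using below(2) by (intro arg_cong[of _ _ card]) force
    also have "\<dots> = card {m \<in> ?A. z m < c} + card {m \<in> ?A. z m = c}"
      by (rule card_Un_disjoint) auto
    finally have 2: "card {m \<in> ?A. z m < c} + card {m \<in> ?A. z m = c} \<ge> k"
      using s by (simp add: reflex_def)
    show ?thesis
      using 1 2 t fin by (simp add: card_Diff_singleton)
  qed
  let ?V = "{m \<in> ?A. x m = a \<and> y m = b}"
  let ?E = "{m \<in> ?A. x m = a \<and> y m < b}" and ?F = "{m \<in> ?A. y m = b \<and> x m < a}"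
  have "card ?N \<le> card {m \<in> ?A. x m = a}"
    by (rule many) (use t in \<open>auto simp: reflex_def above_def\<close>)
  also have "{m \<in> ?A. x m = a} = ?V \<union> ?E"
    by (auto simp: above_def)
  also have "card \<dots> \<le> card ?V + card ?E" by (rule card_Un_le)
  finally have nE: "card ?N \<le> card ?V + card ?E" .
  have "card ?N \<le> card {m \<in> ?A. y m = b}"
    by (rule many) (use t in \<open>auto simp: reflex_def above_def\<close>)
  also have "{m \<in> ?A. y m = b} = ?V \<union> ?F"
    by (auto simp: above_def)
  also have "card \<dots> \<le> card ?V + card ?F" by (rule card_Un_le)
  finally have nF: "card ?N \<le> card ?V + card ?F" .
  have "card ?N \<le> card ?V + card (?E \<times> ?F)"
    using le_add_mult_if_le_add[OF nE nF] by (simp add: card_cartesian_product)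
  also have "card ?V \<le> card {e \<in> P. (x e, y e) = (a, b)}"
    using finite_P by (intro card_mono) (auto simp: above_def)
  also have "card (?E \<times> ?F) \<le> card {(e, f). crossing e f \<and> (x e, y f) = (a, b)}"
  proof (rule card_mono)
    show "finite {(e, f). crossing e f \<and> (x e, y f) = (a, b)}"
      by (rule finite_subset[OF _ finite_crossing]) auto
    show "?E \<times> ?F \<subseteq> {(e, f). crossing e f \<and> (x e, y f) = (a, b)}"
      using s by (auto simp: crossing_def)
  qed
  finally show ?thesis by simp
qed (simp only: card.empty)

text \<open>
  If no left edge were on the line \<open>x = a\<close>, then all of the at least \<open>k\<close> squares above \<open>d\<close> that contain
  the vertex would start to the left of it. So there are only finitely many reflex vertices.
\<close>

lemma reflex_coordinates:
  assumes "reflex d a b"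
  shows "a \<in> x ` P" "b \<in> y ` P"
proof -
  have touch: "c \<in> z ` P"
    if "card {m \<in> above d a b. z m < c} < k" "\<And>m. m \<in> above d a b \<Longrightarrow> z m \<le> c"
    for z :: "'a \<Rightarrow> real" and c
  proof (rule ccontr)
    assume "c \<notin> z ` P"
    then have "{m \<in> above d a b. z m < c} = above d a b"
      using that(2) by (force simp: above_def)
    then show False using that(1) assms by (simp add: reflex_def)
  qed
  show "a \<in> x ` P" "b \<in> y ` P"
    by (rule touch; use assms in \<open>auto simp: reflex_def above_def\<close>)+
qed

lemma finite_reflex: "finite {(d, a, b). reflex d a b}"
  by (rule finite_subset[of _ "P \<times> x ` P \<times> y ` P"])
     (use finite_P reflex_coordinates in \<open>auto simp: reflex_def\<close>)

theorem card_reflex: "card {(d, a, b). reflex d a b} \<le> (2 * k - 1) * card P"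
proof -
  let ?R = "{(d, a, b). reflex d a b}" and ?T = "x ` P \<times> y ` P"
  let ?X = "{(e, f). crossing e f}"
  have finT: "finite ?T" using finite_P by simp
  have "card {s \<in> ?R. snd s = c} \<le>
      card {e \<in> P. (x e, y e) = c} + card {s \<in> ?X. (\<lambda>(e, f). (x e, y f)) s = c}" for c
  proof -
    obtain a b where c: "c = (a, b)" by force
    have "{s \<in> ?R. snd s = c} = (\<lambda>d. (d, a, b)) ` {d. reflex d a b}"
      by (auto simp: c)
    then have "card {s \<in> ?R. snd s = c} = card {d. reflex d a b}"
      by (simp add: card_image inj_on_def)
    moreover have "{s \<in> ?X. (\<lambda>(e, f). (x e, y f)) s = c} =
        {(e, f). crossing e f \<and> (x e, y f) = (a, b)}"
      by (auto simp: c)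
    ultimately show ?thesis
      using card_reflex_at[of a b] by (simp add: c)
  qed
  then have "(\<Sum>c\<in>?T. card {s \<in> ?R. snd s = c}) \<le>
      (\<Sum>c\<in>?T. card {e \<in> P. (x e, y e) = c}) +
      (\<Sum>c\<in>?T. card {s \<in> ?X. (\<lambda>(e, f). (x e, y f)) s = c})"
    by (simp add: sum_mono flip: sum.distrib)
  also have "(\<Sum>c\<in>?T. card {s \<in> ?R. snd s = c}) = card ?R"
    using reflex_coordinates by (intro sum_card_fibres finT finite_reflex) auto
  also have "(\<Sum>c\<in>?T. card {e \<in> P. (x e, y e) = c}) = card P"
    by (intro sum_card_fibres finT finite_P) auto
  also have "(\<Sum>c\<in>?T. card {s \<in> ?X. (\<lambda>(e, f). (x e, y f)) s = c}) = card ?X"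
    using crossing_in_P by (intro sum_card_fibres finT finite_crossing) auto
  also have "card P + card ?X \<le> (1 + 2 * (k - 1)) * card P"
    using card_crossing by simp
  also have "1 + 2 * (k - 1) = 2 * k - 1" using k_pos by simp
  finally show ?thesis .
qed

end

section \<open>Reflex vertices of the stair polygons\<close>

text \<open>
  An intersection of translates of a square is a rectangle, whose \<open>\<prec>\<close>-infimum is its lower left
  corner. For \<open>stair_reflex\<close> it matters that the corner is attained in each coordinate by one of the squares.
\<close>

lemma corner_Inter_squares:
  assumes "finite F" "F \<noteq> {}" "q \<in> (\<Inter>E\<in>F. unit_square E)"
  defines "u \<equiv> (Max ((fst \<circ> tvec) ` F), Max ((snd \<circ> tvec) ` F))"
  shows "corner (\<Inter>E\<in>F. unit_square E) = u" "u \<in> (\<Inter>E\<in>F. unit_square E)"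
proof -
  have le: "fst u \<le> fst p \<and> snd u \<le> snd p" if "p \<in> (\<Inter>E\<in>F. unit_square E)" for p
    using that assms(1,2) by (auto simp: u_def unit_square_def)
  have ge: "fst (tvec E) \<le> fst u \<and> snd (tvec E) \<le> snd u" if "E \<in> F" for E
    using that assms(1) by (auto simp: u_def)
  show u: "u \<in> (\<Inter>E\<in>F. unit_square E)"
  proof
    fix E assume E: "E \<in> F"
    then have "q \<in> unit_square E" using assms(3) by blast
    then show "u \<in> unit_square E"
      using le[OF assms(3)] ge[OF E] by (auto simp: unit_square_def mem_Times_iff)
  qed
  show "corner (\<Inter>E\<in>F. unit_square E) = u"
    by (rule corner_eqI[OF u])
       (use le in \<open>force simp: prec_lower_bound_def prec_def prod_eq_iff\<close>)
qed

lemma translate_tvec: "translate_of_triangle D \<Longrightarrow> D = (+) (tvec D) ` triangle"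
  unfolding translate_of_triangle_def using tvec_translate by metis

lemma square_stack_translates:
  assumes "finite P" "\<And>D. D \<in> P \<Longrightarrow> translate_of_triangle D" "0 < k"
  shows "square_stack P (\<lambda>D E. tvec D \<prec> tvec E) k"
proof
  show "tvec D \<prec> tvec E \<or> tvec E \<prec> tvec D" if "D \<in> P" "E \<in> P" "D \<noteq> E" for D E
  proof -
    have "tvec D \<noteq> tvec E"
      using that assms(2) translate_tvec by metis
    then show ?thesis
      by (auto simp: prec_def prod_eq_iff)
  qed
qed (use assms in \<open>auto simp: prec_def\<close>)

lemma less_if_steps_less:
  fixes f :: "nat \<Rightarrow> 'a::order"
  assumes step: "\<And>j. j \<le> r \<Longrightarrow> f j < f (Suc j)" and "m < n" "n \<le> Suc r"
  shows "f m < f n"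
  using assms(2,3)
proof (induction n)
  case (Suc n)
  then show ?case
    using step[of n] by (cases "m = n") (auto intro: less_trans)
qed simp

text \<open>
  The points just left of the reflex vertex \<open>(a, b)\<close> and just below it belong to the staircase, while
  \<open>(a, b)\<close> itself is cut off. So no quadrant that makes up the cut region and contains \<open>(a, b)\<close> can
  extend further left or further down: each of them has its corner exactly at \<open>(a, b)\<close>. One such
  quadrant exists, and it supplies \<open>k\<close> pressing squares that contain the vertex. On the other hand, \<open>k\<close>
  pressing squares that contain the vertex and all start to the left of it, or all below it, would
  give a quadrant with a different corner.
\<close>

lemma stair_reflex:
  fixes X Y :: "nat \<Rightarrow> real"
  assumes stack: "square_stack P (\<lambda>D E. tvec D \<prec> tvec E) k"
    and D: "D \<in> P"
    and X: "\<And>j. j \<le> r \<Longrightarrow> X j < X (Suc j)" and Y: "\<And>j. j \<le> r \<Longrightarrow> Y (Suc j) < Y j"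
    and S: "stair_region k P D = (\<Union>j\<le>r. {X j..<X (Suc j)} \<times> {Y (Suc r)..<Y j})"
    and i: "i < r"
  shows "square_stack.reflex P (fst \<circ> tvec) (snd \<circ> tvec) (\<lambda>D E. tvec D \<prec> tvec E) k
     D (X (Suc i)) (Y (Suc i))"
proof -
  interpret square_stack P "fst \<circ> tvec" "snd \<circ> tvec" "\<lambda>D E. tvec D \<prec> tvec E" k
    by (rule stack)
  let ?S = "stair_region k P D" and ?U = "cut_region k P D"
  define a b where "a = X (Suc i)" and "b = Y (Suc i)"
  define I where "I F = (\<Inter>E\<in>F. unit_square E)" for F
  have Xmono: "X m < X n" if "m < n" "n \<le> Suc r" for m n
    using less_if_steps_less[of r X m n] X that by blast
  have Ymono: "Y n < Y m" if "m < n" "n \<le> Suc r" for m n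
    using less_if_steps_less[of r "\<lambda>j. - Y j" m n] Y that by simp
  have in_S: "(p, q) \<in> ?S" if "j \<le> r" "X j \<le> p" "p < X (Suc j)" "Y (Suc r) \<le> q" "q < Y j" for j p q
    using that by (auto simp: S)
  have in_square: "p \<in> unit_square D" "p \<notin> ?U" if "p \<in> ?S" for p
    using that by (auto simp: stair_region_def)
  have X_le: "X 0 < a" "a \<le> X r" "a < X (Suc (Suc i))"
    using i X[of r] Xmono[of 0 "Suc i"] Xmono[of "Suc i" r] Xmono[of "Suc i" "Suc (Suc i)"]
    by (cases "Suc i = r"; force simp: a_def)+
  have Y_le: "Y (Suc r) < b" "b < Y i" "b < Y 0"
    using i Ymono[of "Suc i" "Suc r"] Ymono[of i "Suc i"] Ymono[of 0 "Suc i"]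
    by (auto simp: b_def)
  have D_strict: "fst (tvec D) < a" "a < fst (tvec D) + 1" "snd (tvec D) < b" "b < snd (tvec D) + 1"
    using in_square(1)[OF in_S[of 0 "X 0" "Y (Suc r)"]] in_square(1)[OF in_S[of r "X r" "Y (Suc r)"]]
      in_square(1)[OF in_S[of 0 "X 0" b]] X[of 0] X[of r] Y[of r] X_le Y_le
    by (auto simp: unit_square_def)
  then have abD: "(a, b) \<in> unit_square D"
    by (simp add: unit_square_def)
  have "(a, b) \<notin> ?S"
  proof
    assume "(a, b) \<in> ?S"
    then obtain j where j: "j \<le> r" "X j \<le> a" "a < X (Suc j)" "b < Y j"
      by (auto simp: S)
    show False
    proof (cases "j \<le> i")
      case True
      then show False
        using j(3) Xmono[of "Suc j" "Suc i"] i by (cases "j = i") (auto simp: a_def)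
    next
      case False
      then show False
        using j(1,4) Ymono[of "Suc i" j] by (cases "j = Suc i") (auto simp: b_def)
    qed
  qed
  then have "(a, b) \<in> ?U"
    using abD by (simp add: stair_region_def)
  then obtain F where F: "F \<subseteq> pressing P D" "card F = k" "I F \<noteq> {}"
    and quad: "(a, b) \<in> quadrant (corner (I F))"
    by (auto simp: cut_region_def I_def)
  have left: "(p, b) \<notin> ?U" if "X i \<le> p" "p < a" for p
    by (rule in_square(2)[OF in_S[of i]]) (use that i Y_le in \<open>auto simp: a_def\<close>)
  have down: "(a, q) \<notin> ?U" if "Y (Suc r) \<le> q" "q < b" for q
    by (rule in_square(2)[OF in_S[of "Suc i"]]) (use that i X_le in \<open>auto simp: a_def b_def\<close>)
  have corner_eq: "corner (I G) = (a, b)"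
    if G: "G \<subseteq> pressing P D" "card G = k" "I G \<noteq> {}"
      and le: "fst (corner (I G)) \<le> a" "snd (corner (I G)) \<le> b" for G
  proof -
    have cut: "p \<in> ?U" if "p \<in> quadrant (corner (I G))" for p
      using that G by (auto simp: cut_region_def I_def)
    have "\<not> fst (corner (I G)) < a"
    proof
      assume less: "fst (corner (I G)) < a"
      \<comment> \<open>A point left of the vertex, in the quadrant but also in the staircase: staying
        to the right of \<open>X i\<close> keeps it in the preceding step, whose height exceeds \<open>b\<close>.\<close>
      let ?p = "max (fst (corner (I G))) (X i)"
      have "(?p, b) \<in> ?U"
        using le by (intro cut) (auto simp: quadrant_def)
      then show False
        using left[of ?p] less X[of i] i by (simp add: a_def)
    qed
    moreover have "\<not> snd (corner (I G)) < b"
    proof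
      assume less: "snd (corner (I G)) < b"
      let ?q = "max (snd (corner (I G))) (Y (Suc r))"
      have "(a, ?q) \<in> ?U"
        using le by (intro cut) (auto simp: quadrant_def)
      then show False
        using down[of ?q] less Y_le by simp
    qed
    ultimately show ?thesis
      using le by (simp add: prod_eq_iff)
  qed
  have above: "above D a b = {E \<in> pressing P D. (a, b) \<in> unit_square E}"
  proof -
    have "above D a b = {E \<in> P. tvec D \<prec> tvec E \<and> (a, b) \<in> unit_square E}"
      by (auto simp: above_def unit_square_def)
    then show ?thesis
      using abD lt_irrefl by (auto simp: pressing_def presses_def)
  qed
  have fin: "finite F" "F \<noteq> {}"
    using F(2) k_pos by (auto intro: card_ge_0_finite)
  have "corner (I F) = (a, b)"
    using F quad by (intro corner_eq) (auto simp: quadrant_def)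
  then have "(a, b) \<in> I F"
    using F(3) corner_Inter_squares[OF fin] by (auto simp: I_def)
  then have "F \<subseteq> above D a b"
    using F(1) by (auto simp: above I_def)
  then have ge: "k \<le> card (above D a b)"
    unfolding F(2)[symmetric] by (rule card_mono[OF finite_above])
  have less: "card {m \<in> above D a b. z m < c} < k"
    if z: "(z, c) = (fst \<circ> tvec, a) \<or> (z, c) = (snd \<circ> tvec, b)" for z c
  proof (rule ccontr)
    assume "\<not> ?thesis"
    then obtain G where G: "G \<subseteq> {m \<in> above D a b. z m < c}" "card G = k"
      by (meson not_less obtain_subset_with_card_n)
    have finG: "finite G" "G \<noteq> {}"
      using G(2) k_pos by (auto intro: card_ge_0_finite)
    have GP: "G \<subseteq> pressing P D" and abG: "(a, b) \<in> I G"
      using G(1) by (auto simp: above I_def)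
    note max = corner_Inter_squares[OF finG abG[unfolded I_def], folded I_def]
    have "fst (corner (I G)) \<le> a" "snd (corner (I G)) \<le> b"
      using G(1) finG by (auto simp: max(1) above_def)
    then have "corner (I G) = (a, b)"
      using GP G(2) abG by (intro corner_eq) auto
    moreover have "Max (z ` G) < c"
      using G(1) finG by auto
    ultimately show False
      using z max(1) by auto
  qed
  show ?thesis
    unfolding reflex_def a_def[symmetric] b_def[symmetric]
    using D D_strict ge less[of "fst \<circ> tvec" a] less[of "snd \<circ> tvec" b] by simp
qed

theorem lemma4p10:
  fixes k :: nat and l :: real
    and P :: "(real \<times> real) set set"
    and r :: "(real \<times> real) set \<Rightarrow> nat"
  assumes "k > 0" and "l > 0"
    and "normal_packing k l P"
    and "\<And>D. D \<in> P \<Longrightarrow> stair_polygon (r D) (stair_region k P D)"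
  shows "(\<Sum>D\<in>P. r D) \<le> (2 * k - 1) * card P"
proof -
  have fin: "finite P" and tr: "\<And>D. D \<in> P \<Longrightarrow> translate_of_triangle D"
    using assms(3) by (auto simp: normal_packing_def)
  interpret square_stack P "fst \<circ> tvec" "snd \<circ> tvec" "\<lambda>D E. tvec D \<prec> tvec E" k
    by (rule square_stack_translates[OF fin tr assms(1)])
  have fin_ab: "finite {(a, b). reflex D a b}" for D
  proof (rule finite_subset)
    show "{(a, b). reflex D a b} \<subseteq> (fst \<circ> tvec) ` P \<times> (snd \<circ> tvec) ` P"
      using reflex_coordinates by blast
  qed (use fin in simp)
  have "r D \<le> card {(a, b). reflex D a b}" if D: "D \<in> P" for D
  proof -
    obtain X Y :: "nat \<Rightarrow> real" where
      X: "\<And>j. j \<le> r D \<Longrightarrow> X j < X (Suc j)" and Y: "\<And>j. j \<le> r D \<Longrightarrow> Y (Suc j) < Y j"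
      and S: "stair_region k P D = (\<Union>j\<le>r D. {X j..<X (Suc j)} \<times> {Y (Suc (r D))..<Y j})"
      using assms(4)[OF D] unfolding stair_polygon_def by blast
    let ?c = "\<lambda>i. (X (Suc i), Y (Suc i))"
    have "inj_on ?c {..<r D}"
    proof (rule linorder_inj_onI')
      fix i j assume "i \<in> {..<r D}" "j \<in> {..<r D}" "i < j"
      then have "X (Suc i) < X (Suc j)"
        using less_if_steps_less[of "r D" X "Suc i" "Suc j"] X by simp
      then show "?c i \<noteq> ?c j" by simp
    qed
    moreover have "?c ` {..<r D} \<subseteq> {(a, b). reflex D a b}"
      using stair_reflex[OF square_stack_axioms D X Y S] by (auto intro!: image_subsetI)
    ultimately have "card {..<r D} \<le> card {(a, b). reflex D a b}"
      by (rule card_inj_on_le[OF _ _ fin_ab])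
    then show ?thesis by simp
  qed
  then have "(\<Sum>D\<in>P. r D) \<le> (\<Sum>D\<in>P. card {(a, b). reflex D a b})"
    by (rule sum_mono)
  also have "\<dots> = card (SIGMA D:P. {(a, b). reflex D a b})"
    using fin fin_ab by simp
  also have "(SIGMA D:P. {(a, b). reflex D a b}) = {(D, a, b). reflex D a b}"
    by (auto simp: reflex_def)
  also have "card \<dots> \<le> (2 * k - 1) * card P"
    by (rule card_reflex)
  finally show ?thesis .
qed

end
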